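(* There exists a numerical constant $c_1>0$ such that, for every strategy $\pi$ whose action rule uses neither the moment order nor the moment bound of the instance, for all $T\ge K\ge2$ and all $0<\epsilon\le\epsilon'\le1$: if $\Phi_{\epsilon'}^\pi(K,T)\le T/4$, then $$\Phi_\epsilon^\pi(K,T)\,\Phi_{\epsilon'}^\pi(K,T)^{\frac{\epsilon}{1+\epsilon}}\ \ge\ c_1\,T\,K^{\frac{\epsilon}{1+\epsilon}} .$$
   Context: Bandit model. There are $K\ge 2$ arms and a horizon of $T\ge1$ rounds. An instance is a tuple $\underline\nu=(\nu_1,\dots,\nu_K)$ of probability distributions on $\mathbb R$. Successive pulls of arm $i$ produce i.i.d. rewards from $\nu_i$, independently across arms. At each round $t$ the learner picks an arm $I_t\in\{1,\dots,K\}$ by a possibly randomized rule depending only on the history up to round $t-1$, and observes a reward of that arm. A strategy $\pi$ specifies such a rule for every $K$ and $T$; "uses neither the moment order nor the moment bound" means that the same rule is used for all instances and all moment orders $\epsilon$. With $\mu_i=\mathbb E_{X\sim\nu_i}[X]$ and $\mu^*=\max_i\mu_i$, the expected regret is $R_T^\pi(\underline\nu)=\mathbb E_{\underline\nu,\pi}\big[\sum_{t=1}^T(\mu^*-\mu_{I_t})\big]$, the expectation being over rewards and the strategy's internal randomness. For $\epsilon\in(0,1]$ the intrinsic moment scale of an instance is $$U_\epsilon(\underline\nu)=\max_{i\in\{1,\dots,K\}}\big(\mathbb E_{X\sim\nu_i}[|X|^{1+\epsilon}]\big)^{\frac1{1+\epsilon}},$$ and the normalized regret profile of $\pi$ is $$\Phi_\epsilon^\pi(K,T)=\sup_{\underline\nu:\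 0<U_\epsilon(\underline\nu)<+\infty}\frac{R_T^\pi(\underline\nu)}{U_\epsilon(\underline\nu)},$$ the supremum being over $K$-armed instances. *)

theory Defs
  imports "HOL-Probability.Probability"
begin

text \<open>
  A history is the list of (arm, reward) pairs observed so far, oldest first.  A strategy assigns
  to the number of arms \<open>K\<close>, the horizon \<open>T\<close> and the current history the distribution of the next
  arm; the arms are numbered \<open>1, \<dots>, K\<close>.  As neither a moment order nor a moment bound is among
  its arguments, the same rule is used whatever the instance and whatever \<open>\<epsilon>\<close>.
\<close>

type_synonym history = "(nat \<times> real) list"

type_synonym strategy = "nat \<Rightarrow> nat \<Rightarrow> history \<Rightarrow> nat pmf"

text \<open>
  Measurability of the rule is required separately for every sequence \<open>as\<close> of past arms, in the
  vector of the rewards obtained from them.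
\<close>

definition bandit_strategy :: "strategy \<Rightarrow> bool" where
  "bandit_strategy \<pi> \<longleftrightarrow>
     (\<forall>K T. 2 \<le> K \<longrightarrow> 1 \<le> T \<longrightarrow>
        (\<forall>h. length h < T \<longrightarrow> fst ` set h \<subseteq> {1..K} \<longrightarrow> set_pmf (\<pi> K T h) \<subseteq> {1..K}) \<and>
        (\<forall>as j. length as < T \<longrightarrow> set as \<subseteq> {1..K} \<longrightarrow>
           (\<lambda>x. pmf (\<pi> K T (zip as (map x [0..<length as]))) j)
             \<in> borel_measurable (PiM {..<length as} (\<lambda>_. borel :: real measure))))"

text \<open>Only the values \<open>\<nu> i\<close> with \<open>i \<in> {1..K}\<close> matter.\<close>

definition bandit_instance :: "nat \<Rightarrow> (nat \<Rightarrow> real measure) \<Rightarrow> bool" where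
  "bandit_instance K \<nu> \<longleftrightarrow> (\<forall>i\<in>{1..K}. prob_space (\<nu> i) \<and> sets (\<nu> i) = sets borel)"

text \<open>
  The reward table: \<open>\<omega> (i, s)\<close> is the reward produced by the pull of arm \<open>i\<close> that is preceded by
  exactly \<open>s\<close> pulls of that arm.  Within \<open>T\<close> rounds only \<open>s < T\<close> can occur.
\<close>

definition reward_table :: "nat \<Rightarrow> nat \<Rightarrow> (nat \<Rightarrow> real measure) \<Rightarrow> (nat \<times> nat \<Rightarrow> real) measure" where
  "reward_table K T \<nu> = PiM ({1..K} \<times> {..<T}) (\<lambda>(i, s). \<nu> i)"

definition pulls :: "nat \<Rightarrow> history \<Rightarrow> nat" where
  "pulls i h = length (filter (\<lambda>(a, x). a = i) h)"

text \<open>The law, over the internal randomness of the rule, of the history of the first \<open>t\<close> rounds,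
  given the reward table \<open>\<omega>\<close>.\<close>

primrec history_pmf ::
  "(history \<Rightarrow> nat pmf) \<Rightarrow> (nat \<times> nat \<Rightarrow> real) \<Rightarrow> nat \<Rightarrow> history pmf" where
  "history_pmf rule \<omega> 0 = return_pmf []"
| "history_pmf rule \<omega> (Suc t) =
     bind_pmf (history_pmf rule \<omega> t) (\<lambda>h.
     bind_pmf (rule h) (\<lambda>a.
     return_pmf (h @ [(a, \<omega> (a, pulls a h))])))"

definition arm_mean :: "(nat \<Rightarrow> real measure) \<Rightarrow> nat \<Rightarrow> real" where
  "arm_mean \<nu> i = (\<integral>x. x \<partial>\<nu> i)"

definition best_mean :: "nat \<Rightarrow> (nat \<Rightarrow> real measure) \<Rightarrow> real" where
  "best_mean K \<nu> = Max (arm_mean \<nu> ` {1..K})"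

definition expected_regret :: "strategy \<Rightarrow> nat \<Rightarrow> nat \<Rightarrow> (nat \<Rightarrow> real measure) \<Rightarrow> real" where
  "expected_regret \<pi> K T \<nu> =
     (\<integral>\<omega>. (\<integral>h. (\<Sum>(a, x)\<leftarrow>h. best_mean K \<nu> - arm_mean \<nu> a)
            \<partial>measure_pmf (history_pmf (\<pi> K T) \<omega> T)) \<partial>reward_table K T \<nu>)"

text \<open>
  The intrinsic moment scale is infinite exactly if \<open>finite_moment\<close> fails; \<open>moment_scale\<close>
  is its value otherwise.
\<close>

definition finite_moment :: "real \<Rightarrow> nat \<Rightarrow> (nat \<Rightarrow> real measure) \<Rightarrow> bool" where
  "finite_moment \<epsilon> K \<nu> \<longleftrightarrow> (\<forall>i\<in>{1..K}. integrable (\<nu> i) (\<lambda>x. \<bar>x\<bar> powr (1 + \<epsilon>)))"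

definition moment_scale :: "real \<Rightarrow> nat \<Rightarrow> (nat \<Rightarrow> real measure) \<Rightarrow> real" where
  "moment_scale \<epsilon> K \<nu> =
     Max ((\<lambda>i. (\<integral>x. \<bar>x\<bar> powr (1 + \<epsilon>) \<partial>\<nu> i) powr (1 / (1 + \<epsilon>))) ` {1..K})"

definition admissible_instances :: "real \<Rightarrow> nat \<Rightarrow> (nat \<Rightarrow> real measure) set" where
  "admissible_instances \<epsilon> K =
     {\<nu>. bandit_instance K \<nu> \<and> finite_moment \<epsilon> K \<nu> \<and> 0 < moment_scale \<epsilon> K \<nu>}"

text \<open>
  The supremum is taken in the reals; \<open>admissible_instances_nonempty\<close> and
  \<open>normalized_regret_bdd_above\<close> below show that it is a genuine least upper bound.
\<close>

definition regret_profile :: "strategy \<Rightarrow> real \<Rightarrow> nat \<Rightarrow> nat \<Rightarrow> real" where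
  "regret_profile \<pi> \<epsilon> K T =
     (SUP \<nu>\<in>admissible_instances \<epsilon> K. expected_regret \<pi> K T \<nu> / moment_scale \<epsilon> K \<nu>)"

lemma admissible_instances_nonempty:
  assumes "1 \<le> K"
  shows "admissible_instances \<epsilon> K \<noteq> {}"
proof -
  have "(\<lambda>_. return borel 1) \<in> admissible_instances \<epsilon> K"
    using assms
    by (auto simp: admissible_instances_def bandit_instance_def finite_moment_def moment_scale_def
        prob_space_return integral_return integrable_iff_bounded nn_integral_return)
  then show ?thesis by blast
qed

lemma abs_arm_mean_le:
  assumes \<nu>: "\<nu> \<in> admissible_instances \<epsilon> K" and \<epsilon>: "0 < \<epsilon>" and i: "i \<in> {1..K}"
  shows "\<bar>arm_mean \<nu> i\<bar> \<le> 2 * moment_scale \<epsilon> K \<nu>"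
proof -
  define U where "U = moment_scale \<epsilon> K \<nu>"
  define m where "m = (\<integral>x. \<bar>x\<bar> powr (1 + \<epsilon>) \<partial>\<nu> i)"
  interpret prob_space "\<nu> i"
    using \<nu> i by (auto simp: admissible_instances_def bandit_instance_def)
  have U: "0 < U" and int: "integrable (\<nu> i) (\<lambda>x. \<bar>x\<bar> powr (1 + \<epsilon>))"
    and sets: "sets (\<nu> i) = sets borel"
    using \<nu> i by (auto simp: admissible_instances_def bandit_instance_def finite_moment_def U_def)
  have m0: "0 \<le> m" unfolding m_def by simp
  have "m powr (1 / (1 + \<epsilon>)) \<le> U"
    unfolding U_def moment_scale_def m_def using i by (intro Max_ge) auto
  then have "(m powr (1 / (1 + \<epsilon>))) powr (1 + \<epsilon>) \<le> U powr (1 + \<epsilon>)"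
    using \<epsilon> by (intro powr_mono2) auto
  then have mU: "m \<le> U powr (1 + \<epsilon>)"
    using m0 \<epsilon> by (simp add: powr_powr)
  have pt: "\<bar>x\<bar> \<le> U + \<bar>x\<bar> powr (1 + \<epsilon>) / U powr \<epsilon>" for x :: real
  proof (cases "\<bar>x\<bar> \<le> U")
    case True
    then show ?thesis by (simp add: add_increasing2)
  next
    case False
    then have "U powr \<epsilon> \<le> \<bar>x\<bar> powr \<epsilon>" using U \<epsilon> by (intro powr_mono2) auto
    then have "\<bar>x\<bar> * U powr \<epsilon> \<le> \<bar>x\<bar> * \<bar>x\<bar> powr \<epsilon>" by (intro mult_left_mono) auto
    then have "\<bar>x\<bar> \<le> \<bar>x\<bar> powr (1 + \<epsilon>) / U powr \<epsilon>"
      using U False by (simp add: powr_add field_simps)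
    then show ?thesis using U by simp
  qed
  have "\<bar>arm_mean \<nu> i\<bar> \<le> (\<integral>x. \<bar>x\<bar> \<partial>\<nu> i)"
    unfolding arm_mean_def by (rule integral_abs_bound)
  also have "\<dots> \<le> (\<integral>x. U + \<bar>x\<bar> powr (1 + \<epsilon>) / U powr \<epsilon> \<partial>\<nu> i)"
    using int U pt by (intro integral_mono') (auto intro!: add_nonneg_nonneg)
  also have "\<dots> = U + m / U powr \<epsilon>"
    using int by (simp add: m_def prob_space)
  also have "m / U powr \<epsilon> \<le> U"
    using mU U by (simp add: powr_add field_simps)
  finally show ?thesis unfolding U_def by simp
qed

lemma history_pmf_arms:
  assumes "bandit_strategy \<pi>" "2 \<le> K" "t \<le> T" "h \<in> set_pmf (history_pmf (\<pi> K T) \<omega> t)"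
  shows "length h = t \<and> fst ` set h \<subseteq> {1..K}"
  using assms(3,4)
proof (induction t arbitrary: h)
  case 0
  then show ?case by simp
next
  case (Suc t)
  then obtain g a where g: "g \<in> set_pmf (history_pmf (\<pi> K T) \<omega> t)"
    and a: "a \<in> set_pmf (\<pi> K T g)" and h: "h = g @ [(a, \<omega> (a, pulls a g))]"
    by auto
  have *: "length g = t \<and> fst ` set g \<subseteq> {1..K}" using Suc g by simp
  then have "set_pmf (\<pi> K T g) \<subseteq> {1..K}"
    using assms(1,2) Suc.prems(1) unfolding bandit_strategy_def by auto
  then show ?case using * a h by auto
qed

lemma (in prob_space) integral_le_bound:
  fixes f :: "'a \<Rightarrow> real"
  assumes "0 \<le> B" "AE x in M. f x \<le> B"
  shows "(\<integral>x. f x \<partial>M) \<le> B"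
proof (cases "integrable M f")
  case True
  have "(\<integral>x. f x \<partial>M) \<le> (\<integral>x. B \<partial>M)"
    using assms(2) by (intro integral_mono_AE True) auto
  then show ?thesis by (simp add: prob_space)
next
  case False
  then show ?thesis using assms(1) by (simp add: not_integrable_integral_eq)
qed

lemma normalized_regret_bdd_above:
  assumes \<pi>: "bandit_strategy \<pi>" and K: "2 \<le> K" and \<epsilon>: "0 < \<epsilon>"
  shows "bdd_above ((\<lambda>\<nu>. expected_regret \<pi> K T \<nu> / moment_scale \<epsilon> K \<nu>)
           ` admissible_instances \<epsilon> K)"
proof (rule bdd_aboveI2)
  fix \<nu> assume \<nu>: "\<nu> \<in> admissible_instances \<epsilon> K"
  define U where "U = moment_scale \<epsilon> K \<nu>"
  have U: "0 < U" using \<nu> by (auto simp: admissible_instances_def U_def)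
  have inst: "prob_space (\<nu> i)" if "i \<in> {1..K}" for i
    using \<nu> that by (auto simp: admissible_instances_def bandit_instance_def)
  have best: "best_mean K \<nu> \<le> 2 * U"
    unfolding best_mean_def U_def
    using K abs_arm_mean_le[OF \<nu> \<epsilon>] by (subst Max_le_iff) (auto simp: abs_le_iff)
  have gap: "best_mean K \<nu> - arm_mean \<nu> a \<le> 4 * U" if "a \<in> {1..K}" for a
    using best abs_arm_mean_le[OF \<nu> \<epsilon> that] unfolding U_def by linarith
  have sum_le: "(\<Sum>(a, x)\<leftarrow>h. best_mean K \<nu> - arm_mean \<nu> a) \<le> real (length h) * (4 * U)"
    if "fst ` set h \<subseteq> {1..K}" for h :: history
    using that
  proof (induction h)
    case (Cons p h)
    obtain a x where p: "p = (a, x)" by (cases p)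
    show ?case using Cons gap[of a] by (simp add: p ring_distribs)
  qed simp
  have inner: "(\<integral>h. (\<Sum>(a, x)\<leftarrow>h. best_mean K \<nu> - arm_mean \<nu> a)
      \<partial>measure_pmf (history_pmf (\<pi> K T) \<omega> T)) \<le> real T * (4 * U)" for \<omega>
  proof (rule measure_pmf.integral_le_bound)
    show "AE h in measure_pmf (history_pmf (\<pi> K T) \<omega> T).
        (\<Sum>(a, x)\<leftarrow>h. best_mean K \<nu> - arm_mean \<nu> a) \<le> real T * (4 * U)"
      using sum_le history_pmf_arms[OF \<pi> K order.refl] by (force simp: AE_measure_pmf_iff)
  qed (use U in simp)
  have "prob_space (reward_table K T \<nu>)"
    unfolding reward_table_def by (rule prob_space_PiM) (use inst in auto)
  then have "expected_regret \<pi> K T \<nu> \<le> real T * (4 * U)"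
    unfolding expected_regret_def using U inner by (intro prob_space.integral_le_bound) auto
  then show "expected_regret \<pi> K T \<nu> / moment_scale \<epsilon> K \<nu> \<le> 4 * real T"
    using U by (simp add: U_def field_simps)
qed

end

theory Submission imports Defs begin

text \<open>
  Two instances are compared.  In the base instance arm 1 always pays 1 and the others 0, so some
  arm \<open>i \<noteq> 1\<close> is pulled at most \<open>A / (K - 1)\<close> times on average, where \<open>A\<close> is the regret
  profile at \<open>\<epsilon>'\<close>.  In the alternative arm \<open>i\<close> pays \<open>2 / p\<close> with probability
  \<open>p = (K - 1) / (4 * A)\<close> and 0 otherwise.  Its mean is now 2, but with substantial probability
  the strategy never sees the large reward and acts as in the base instance; its regret is then at
  least \<open>T / 2\<close>, whereas the moment scale at \<open>\<epsilon>\<close> is only \<open>2 * p powr (- (\<epsilon> / (1 + \<epsilon>)))\<close>.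
\<close>

section \<open>Arm sequences and their probabilities for a fixed reward table\<close>

text \<open>Given the table, the rewards are determined by the arms: the number of earlier pulls is
  the second index of the cell read at a round.\<close>

definition observations :: "(nat \<times> nat \<Rightarrow> real) \<Rightarrow> nat list \<Rightarrow> history" where
  "observations \<omega> as =
     zip as (map (\<lambda>s. \<omega> (as ! s, count_list (take s as) (as ! s))) [0..<length as])"

lemma observations_Nil [simp]: "observations \<omega> [] = []"
  by (simp add: observations_def)

lemma observations_snoc:
  "observations \<omega> (as @ [a]) = observations \<omega> as @ [(a, \<omega> (a, count_list as a))]"
proof -
  have eq: "map (\<lambda>s. \<omega> ((as @ [a]) ! s, count_list (take s (as @ [a])) ((as @ [a]) ! s))) [0..<length as]
      = map (\<lambda>s. \<omega> (as ! s, count_list (take s as) (as ! s))) [0..<length as]"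
    by (auto simp: nth_append)
  have "take (length as) (as @ [a]) = as" by simp
  then show ?thesis
    by (simp add: observations_def eq del: take_append)
qed

lemma map_fst_observations [simp]: "map fst (observations \<omega> as) = as"
  by (simp add: observations_def)

lemma pulls_observations: "pulls a (observations \<omega> as) = count_list as a"
  by (induction as rule: rev_induct) (auto simp: pulls_def observations_snoc)

lemma observations_cong:
  assumes "\<And>s. s < length as \<Longrightarrow>
    \<omega> (as ! s, count_list (take s as) (as ! s)) = \<omega>' (as ! s, count_list (take s as) (as ! s))"
  shows "observations \<omega> as = observations \<omega>' as"
  unfolding observations_def using assms by (intro arg_cong2[where f = zip] map_cong) auto

primrec arms_pmf ::
  "(history \<Rightarrow> nat pmf) \<Rightarrow> (nat \<times> nat \<Rightarrow> real) \<Rightarrow> nat \<Rightarrow> nat list pmf" where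
  "arms_pmf rule \<omega> 0 = return_pmf []"
| "arms_pmf rule \<omega> (Suc t) =
     bind_pmf (arms_pmf rule \<omega> t) (\<lambda>as. map_pmf (\<lambda>a. as @ [a]) (rule (observations \<omega> as)))"

text \<open>Once the table is fixed, all randomness of a history lies in its arms, so it suffices to
  study laws on the finite set of arm sequences.\<close>

lemma history_pmf_eq_map_arms_pmf:
  "history_pmf rule \<omega> t = map_pmf (observations \<omega>) (arms_pmf rule \<omega> t)"
proof (induction t)
  case (Suc t)
  show ?case
    by (simp add: Suc map_bind_pmf bind_map_pmf map_pmf_comp observations_snoc pulls_observations)
       (simp add: map_pmf_def)
qed simp

text \<open>For a fixed arm sequence this is a real function of the table, so it can be integrated;
  expectations over histories become finite sums of such weights.\<close>

definition path_prob :: "(history \<Rightarrow> nat pmf) \<Rightarrow> (nat \<times> nat \<Rightarrow> real) \<Rightarrow> nat list \<Rightarrow> real" where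
  "path_prob rule \<omega> as = (\<Prod>s<length as. pmf (rule (observations \<omega> (take s as))) (as ! s))"

lemma path_prob_nonneg: "0 \<le> path_prob rule \<omega> as"
  by (simp add: path_prob_def prod_nonneg)

lemma path_prob_le_1: "path_prob rule \<omega> as \<le> 1"
  by (simp add: path_prob_def prod_le_1 pmf_le_1)

lemma path_prob_snoc:
  "path_prob rule \<omega> (as @ [a]) = path_prob rule \<omega> as * pmf (rule (observations \<omega> as)) a"
  by (simp add: path_prob_def nth_append)

text \<open>The rule sees the table only through the cells read along \<open>as\<close>. This lets a
  random table be replaced by a constant one whenever the two agree there.\<close>

lemma path_prob_cong:
  assumes "\<And>s. s < length as \<Longrightarrow>
    \<omega> (as ! s, count_list (take s as) (as ! s)) = \<omega>' (as ! s, count_list (take s as) (as ! s))"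
  shows "path_prob rule \<omega> as = path_prob rule \<omega>' as"
proof -
  have "observations \<omega> (take s as) = observations \<omega>' (take s as)" if "s < length as" for s
    using assms that by (intro observations_cong) (auto simp: min_def)
  then show ?thesis
    unfolding path_prob_def by (intro prod.cong) auto
qed

lemma pmf_arms_pmf:
  assumes "length as = t"
  shows "pmf (arms_pmf rule \<omega> t) as = path_prob rule \<omega> as"
  using assms
proof (induction t arbitrary: as)
  case 0
  then show ?case by (simp add: path_prob_def)
next
  case (Suc t)
  then obtain bs b where as: "as = bs @ [b]" and bs: "length bs = t"
    by (metis length_Suc_conv_rev)
  \<comment> \<open>A nonempty list splits uniquely into a prefix and a last element, so only the
    prefix \<open>bs\<close> contributes to the mixture.\<close>
  have "pmf (map_pmf (\<lambda>a. cs @ [a]) (rule (observations \<omega> cs))) (bs @ [b])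
      = indicator {bs} cs * pmf (rule (observations \<omega> bs)) b" for cs
  proof (cases "cs = bs")
    case True
    have "inj (\<lambda>a. bs @ [a])" by (auto intro: injI)
    from pmf_map_inj'[OF this] show ?thesis by (simp add: True)
  next
    case False
    then show ?thesis by (subst pmf_map_outside) auto
  qed
  then have "pmf (arms_pmf rule \<omega> (Suc t)) as
      = (\<integral>cs. indicator {bs} cs * pmf (rule (observations \<omega> bs)) b \<partial>measure_pmf (arms_pmf rule \<omega> t))"
    by (simp only: as arms_pmf.simps pmf_bind)
  also have "\<dots> = pmf (arms_pmf rule \<omega> t) bs * pmf (rule (observations \<omega> bs)) b"
    by (simp add: measure_pmf_single)
  finally have "pmf (arms_pmf rule \<omega> (Suc t)) as
      = pmf (arms_pmf rule \<omega> t) bs * pmf (rule (observations \<omega> bs)) b" .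
  then show ?case
    using Suc.IH[OF bs] by (simp add: as path_prob_snoc)
qed

abbreviation arm_paths :: "nat \<Rightarrow> nat \<Rightarrow> nat list set" where
  "arm_paths K T \<equiv> {as. set as \<subseteq> {1..K} \<and> length as = T}"

lemma finite_arm_paths: "finite (arm_paths K T)"
  by (intro finite_lists_length_eq) auto

lemma set_arms_pmf:
  assumes "bandit_strategy \<pi>" "2 \<le> K"
  shows "set_pmf (arms_pmf (\<pi> K T) \<omega> T) \<subseteq> arm_paths K T"
proof
  fix as assume "as \<in> set_pmf (arms_pmf (\<pi> K T) \<omega> T)"
  then have "observations \<omega> as \<in> set_pmf (history_pmf (\<pi> K T) \<omega> T)"
    by (simp add: history_pmf_eq_map_arms_pmf)
  from history_pmf_arms[OF assms order.refl this] show "as \<in> arm_paths K T"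
    by (metis (mono_tags, lifting) length_map list.set_map map_fst_observations mem_Collect_eq)
qed

lemma sum_path_prob:
  assumes "bandit_strategy \<pi>" "2 \<le> K"
  shows "(\<Sum>as\<in>arm_paths K T. path_prob (\<pi> K T) \<omega> as) = 1"
  using sum_pmf_eq_1[OF finite_arm_paths set_arms_pmf[OF assms]]
  by (simp add: pmf_arms_pmf)

text \<open>The regret of a history depends on its arms alone. The finite sum on the right can later
  be interchanged with the integral over the table.\<close>

lemma integral_history_pmf:
  fixes g :: "nat \<Rightarrow> real"
  assumes "bandit_strategy \<pi>" "2 \<le> K"
  shows "(\<integral>h. (\<Sum>(a, x)\<leftarrow>h. g a) \<partial>measure_pmf (history_pmf (\<pi> K T) \<omega> T))
       = (\<Sum>as\<in>arm_paths K T. path_prob (\<pi> K T) \<omega> as * (\<Sum>a\<leftarrow>as. g a))"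
proof -
  have "(\<Sum>(a, x)\<leftarrow>observations \<omega> as. g a) = (\<Sum>a\<leftarrow>as. g a)" for as
  proof -
    have "map (\<lambda>(a, x). g a) h = map g (map fst h)" for h :: history
      by (simp add: case_prod_beta)
    from this[of "observations \<omega> as"] show ?thesis
      by (simp only: map_fst_observations)
  qed
  then have "(\<integral>h. (\<Sum>(a, x)\<leftarrow>h. g a) \<partial>measure_pmf (history_pmf (\<pi> K T) \<omega> T))
      = (\<integral>as. (\<Sum>a\<leftarrow>as. g a) \<partial>measure_pmf (arms_pmf (\<pi> K T) \<omega> T))"
    by (simp add: history_pmf_eq_map_arms_pmf)
  also have "\<dots> = (\<Sum>as\<in>arm_paths K T. (\<Sum>a\<leftarrow>as. g a) * pmf (arms_pmf (\<pi> K T) \<omega> T) as)"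
    using set_arms_pmf[OF assms] by (intro integral_measure_pmf_real finite_arm_paths) auto
  also have "\<dots> = (\<Sum>as\<in>arm_paths K T. path_prob (\<pi> K T) \<omega> as * (\<Sum>a\<leftarrow>as. g a))"
    by (intro sum.cong) (auto simp: pmf_arms_pmf)
  finally show ?thesis .
qed

section \<open>Path probabilities and regret under a random reward table\<close>

lemma count_list_take_less:
  assumes "s < length as" "length as \<le> T"
  shows "count_list (take s as) a < T"
  using count_le_length[of "take s as" a] assms by simp

lemma sets_reward_table:
  assumes "bandit_instance K \<nu>"
  shows "sets (reward_table K T \<nu>) = sets (PiM ({1..K} \<times> {..<T}) (\<lambda>_. borel :: real measure))"
  unfolding reward_table_def
  using assms by (intro sets_PiM_cong) (auto simp: bandit_instance_def)

text \<open>Each factor has its past arms fixed, which is the setting in which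
  \<open>bandit_strategy\<close> grants measurability in the rewards; these rewards are coordinates
  of the table.\<close>

lemma path_prob_measurable:
  assumes \<pi>: "bandit_strategy \<pi>" and K: "2 \<le> K" and \<nu>: "bandit_instance K \<nu>"
    and as: "set as \<subseteq> {1..K}" "length as \<le> T"
  shows "(\<lambda>\<omega>. path_prob (\<pi> K T) \<omega> as) \<in> borel_measurable (reward_table K T \<nu>)"
  unfolding path_prob_def
proof (rule borel_measurable_prod)
  fix s assume "s \<in> {..<length as}"
  then have s: "s < length as" by simp
  define bs where "bs = take s as"
  have bs: "length bs < T" "set bs \<subseteq> {1..K}"
    using s as set_take_subset[of s as] by (auto simp: bs_def)
  \<comment> \<open>The reward vector along \<open>bs\<close> as a function of the table, restricted
    to \<open>{..<length bs}\<close> so that it lands in the product space of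
    \<open>bandit_strategy\<close>.\<close>
  define X where "X = (\<lambda>\<omega>::nat \<times> nat \<Rightarrow> real. \<lambda>r\<in>{..<length bs}.
    \<omega> (bs ! r, count_list (take r bs) (bs ! r)))"
  have obs: "observations \<omega> bs = zip bs (map (X \<omega>) [0..<length bs])" for \<omega>
    unfolding observations_def X_def by (intro arg_cong2[where f = zip] map_cong) auto
  have X: "X \<in> reward_table K T \<nu> \<rightarrow>\<^sub>M PiM {..<length bs} (\<lambda>_. borel)"
    unfolding X_def
  proof (rule measurable_restrict)
    fix r assume "r \<in> {..<length bs}"
    then have "(bs ! r, count_list (take r bs) (bs ! r)) \<in> {1..K} \<times> {..<T}"
      using bs count_list_take_less[of r bs T] nth_mem[of r bs] by (simp add: subset_iff)
    then show "(\<lambda>\<omega>. \<omega> (bs ! r, count_list (take r bs) (bs ! r)))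
        \<in> reward_table K T \<nu> \<rightarrow>\<^sub>M (borel :: real measure)"
      using measurable_component_singleton[of _ "{1..K} \<times> {..<T}" "\<lambda>_. borel :: real measure"]
        measurable_cong_sets[OF sets_reward_table[OF \<nu>, of T] refl] by blast
  qed
  have "(\<lambda>x. pmf (\<pi> K T (zip bs (map x [0..<length bs]))) (as ! s))
      \<in> borel_measurable (PiM {..<length bs} (\<lambda>_. borel :: real measure))"
    using \<pi> K bs unfolding bandit_strategy_def by auto
  from measurable_compose[OF X this]
  show "(\<lambda>\<omega>. pmf (\<pi> K T (observations \<omega> (take s as))) (as ! s))
      \<in> borel_measurable (reward_table K T \<nu>)"
    by (simp add: obs flip: bs_def)
qed

lemma prob_space_reward_table:
  assumes "bandit_instance K \<nu>"
  shows "prob_space (reward_table K T \<nu>)"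
  unfolding reward_table_def
  using assms by (intro prob_space_PiM) (auto simp: bandit_instance_def)

lemma integrable_path_prob:
  assumes "bandit_strategy \<pi>" "2 \<le> K" "bandit_instance K \<nu>"
    and "set as \<subseteq> {1..K}" "length as \<le> T"
  shows "integrable (reward_table K T \<nu>) (\<lambda>\<omega>. path_prob (\<pi> K T) \<omega> as)"
proof -
  interpret prob_space "reward_table K T \<nu>"
    using assms(3) by (rule prob_space_reward_table)
  show ?thesis
    using path_prob_measurable[OF assms]
    by (intro integrable_const_bound[where B = 1]) (auto simp: path_prob_nonneg path_prob_le_1)
qed

text \<open>
  Only the cells read along \<open>as\<close> matter, so a union bound over these at most \<open>T\<close> cells suffices.
\<close>

lemma integral_path_prob_ge:
  assumes \<pi>: "bandit_strategy \<pi>" and K: "2 \<le> K" and \<nu>: "bandit_instance K \<nu>"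
    and as: "set as \<subseteq> {1..K}" "length as \<le> T"
    and q: "\<And>a. a \<in> {1..K} \<Longrightarrow> measure (\<nu> a) {x. x \<noteq> c a} \<le> q a"
  shows "path_prob (\<pi> K T) (\<lambda>(a, s). c a) as * max 0 (1 - (\<Sum>a\<leftarrow>as. q a))
       \<le> (\<integral>\<omega>. path_prob (\<pi> K T) \<omega> as \<partial>reward_table K T \<nu>)"
proof -
  define M where "M = reward_table K T \<nu>"
  define P where "P = path_prob (\<pi> K T) (\<lambda>(a, s). c a) as"
  define cell where "cell = (\<lambda>s. (as ! s, count_list (take s as) (as ! s)))"
  define E where "E = (\<lambda>s. {\<omega> \<in> space M. \<omega> (cell s) \<noteq> c (as ! s)})"
  \<comment> \<open>On \<open>G\<close> every cell read along \<open>as\<close> holds its default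
    value \<open>c\<close>, so the path probability equals the constant \<open>P\<close>.\<close>
  define G where "G = space M - (\<Union>s<length as. E s)"
  interpret prob_space M
    unfolding M_def using \<nu> by (rule prob_space_reward_table)
  have cell: "cell s \<in> {1..K} \<times> {..<T}" if "s < length as" for s
    using as(1) count_list_take_less[OF that as(2)] nth_mem[OF that]
    by (simp add: cell_def subset_iff)
  have \<nu>a: "prob_space (\<nu> a)" "sets (\<nu> a) = sets borel" if "a \<in> {1..K}" for a
    using \<nu> that by (auto simp: bandit_instance_def)
  have E: "E s \<in> sets M" "prob (E s) \<le> q (as ! s)" if s: "s < length as" for s
  proof -
    have a: "as ! s \<in> {1..K}" using as(1) nth_mem[OF s] by blast
    have proj: "(\<lambda>\<omega>. \<omega> (cell s)) \<in> M \<rightarrow>\<^sub>M \<nu> (as ! s)"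
      using measurable_component_singleton[OF cell[OF s], of "\<lambda>(i, s). \<nu> i"]
      by (simp add: M_def reward_table_def cell_def)
    have E_eq: "E s = (\<lambda>\<omega>. \<omega> (cell s)) -` {x. x \<noteq> c (as ! s)} \<inter> space M"
      by (auto simp: E_def)
    have B: "{x. x \<noteq> c (as ! s)} \<in> sets (\<nu> (as ! s))"
      using \<nu>a[OF a] by simp
    show "E s \<in> sets M"
      unfolding E_eq using proj B by (rule measurable_sets)
    \<comment> \<open>The marginal of the product measure at one cell is the law of its arm, so the
      probability of \<open>E s\<close> is bounded by \<open>q\<close>.\<close>
    have "distr M (\<nu> (as ! s)) (\<lambda>\<omega>. \<omega> (cell s)) = \<nu> (as ! s)"
      using distr_PiM_component[of "{1..K} \<times> {..<T}" "\<lambda>(i, s). \<nu> i" "cell s"] cell[OF s] \<nu>a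
      by (auto simp: M_def reward_table_def cell_def)
    then have "prob (E s) = measure (\<nu> (as ! s)) {x. x \<noteq> c (as ! s)}"
      unfolding E_eq using measure_distr[OF proj B] by simp
    then show "prob (E s) \<le> q (as ! s)" using q[OF a] by simp
  qed
  have G: "G \<in> sets M" unfolding G_def using E by auto
  have "prob (\<Union>s<length as. E s) \<le> (\<Sum>s<length as. prob (E s))"
    using E by (intro finite_measure_subadditive_finite) auto
  also have "\<dots> \<le> (\<Sum>s<length as. q (as ! s))"
    using E by (intro sum_mono) auto
  also have "\<dots> = (\<Sum>a\<leftarrow>as. q a)"
    by (simp add: sum_list_sum_nth atLeast0LessThan)
  finally have "max 0 (1 - (\<Sum>a\<leftarrow>as. q a)) \<le> prob G"
    unfolding G_def using E by (subst prob_compl) auto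
  then have "P * max 0 (1 - (\<Sum>a\<leftarrow>as. q a)) \<le> P * prob G"
    by (intro mult_left_mono) (auto simp: P_def path_prob_nonneg)
  also have "\<dots> = (\<integral>\<omega>. P * indicator G \<omega> \<partial>M)"
    using G by simp
  also have "\<dots> \<le> (\<integral>\<omega>. path_prob (\<pi> K T) \<omega> as \<partial>M)"
  proof (rule integral_mono)
    show "integrable M (\<lambda>\<omega>. path_prob (\<pi> K T) \<omega> as)"
      unfolding M_def by (rule integrable_path_prob[OF \<pi> K \<nu> as])
    show "P * indicator G \<omega> \<le> path_prob (\<pi> K T) \<omega> as" for \<omega>
    proof (cases "\<omega> \<in> G")
      case True
      then have "path_prob (\<pi> K T) \<omega> as = P"
        unfolding P_def by (intro path_prob_cong) (auto simp: G_def E_def cell_def)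
      then show ?thesis using True by simp
    qed (simp add: path_prob_nonneg)
    show "integrable M (\<lambda>\<omega>. P * indicator G \<omega>)"
      using G by (intro integrable_mult_right integrable_real_indicator) (simp_all add: less_top[symmetric])
  qed
  finally show ?thesis unfolding M_def P_def .
qed

lemma arm_mean_le_best_mean: "a \<in> {1..K} \<Longrightarrow> arm_mean \<nu> a \<le> best_mean K \<nu>"
  unfolding best_mean_def by (intro Max_ge) auto

text \<open>Sum and integral are interchanged and \<open>integral_path_prob_ge\<close> is applied
  path by path; the inequality survives because all gaps are nonnegative. The weights on the left
  refer to a deterministic table, so two instances with the same \<open>c\<close> become
  comparable.\<close>

lemma expected_regret_ge:
  assumes \<pi>: "bandit_strategy \<pi>" and K: "2 \<le> K" and \<nu>: "bandit_instance K \<nu>"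
    and q: "\<And>a. a \<in> {1..K} \<Longrightarrow> measure (\<nu> a) {x. x \<noteq> c a} \<le> q a"
  shows "(\<Sum>as\<in>arm_paths K T. path_prob (\<pi> K T) (\<lambda>(a, s). c a) as *
           (max 0 (1 - (\<Sum>a\<leftarrow>as. q a)) * (\<Sum>a\<leftarrow>as. best_mean K \<nu> - arm_mean \<nu> a)))
       \<le> expected_regret \<pi> K T \<nu>"
proof -
  have "expected_regret \<pi> K T \<nu> = (\<integral>\<omega>. (\<Sum>as\<in>arm_paths K T. path_prob (\<pi> K T) \<omega> as *
      (\<Sum>a\<leftarrow>as. best_mean K \<nu> - arm_mean \<nu> a)) \<partial>reward_table K T \<nu>)"
    unfolding expected_regret_def integral_history_pmf[OF \<pi> K] ..
  also have "\<dots> = (\<Sum>as\<in>arm_paths K T. (\<integral>\<omega>. path_prob (\<pi> K T) \<omega> as \<partial>reward_table K T \<nu>) *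
      (\<Sum>a\<leftarrow>as. best_mean K \<nu> - arm_mean \<nu> a))"
    using integrable_path_prob[OF \<pi> K \<nu>] by (subst Bochner_Integration.integral_sum) auto
  finally have eq: "expected_regret \<pi> K T \<nu> = \<dots>" .
  show ?thesis
    unfolding eq mult.assoc[symmetric]
    using arm_mean_le_best_mean
    by (intro sum_mono mult_right_mono integral_path_prob_ge[OF \<pi> K \<nu> _ _ q] sum_list_nonneg)
       (fastforce simp: subset_iff)+
qed

section \<open>The base instance and the alternative: means and moment scales\<close>

text \<open>Also the default value \<open>c\<close> for both instances: a heavy arm other than arm 1
  shows the same 0 until its large reward appears.\<close>

definition base_value :: "nat \<Rightarrow> real" where
  "base_value a = (if a = 1 then 1 else 0)"

definition base_instance :: "nat \<Rightarrow> real measure" where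
  "base_instance a = return borel (base_value a)"

text \<open>The size \<open>2 / p\<close> keeps the mean at 2 for every \<open>p\<close> in
  \<open>(0, 1]\<close>; at \<open>p = 1\<close> the law is the constant 2.\<close>

definition heavy :: "real \<Rightarrow> real measure" where
  "heavy p = distr (measure_pmf (bernoulli_pmf p)) borel (\<lambda>b. if b then 2 / p else 0)"

lemma integrable_heavy:
  fixes f :: "real \<Rightarrow> real"
  assumes "f \<in> borel_measurable borel"
  shows "integrable (heavy p) f"
  unfolding heavy_def using assms
  by (subst integrable_distr_eq) (auto intro!: integrable_measure_pmf_finite)

lemma integral_heavy:
  fixes f :: "real \<Rightarrow> real"
  assumes "f \<in> borel_measurable borel" "0 \<le> p" "p \<le> 1"
  shows "(\<integral>x. f x \<partial>heavy p) = p * f (2 / p) + (1 - p) * f 0"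
  unfolding heavy_def using assms by (subst integral_distr) (auto simp: integral_bernoulli_pmf)

lemma integral_base:
  fixes f :: "real \<Rightarrow> real"
  assumes "f \<in> borel_measurable borel"
  shows "(\<integral>x. f x \<partial>base_instance a) = f (base_value a)"
  unfolding base_instance_def using assms by (intro integral_return) auto

lemma integrable_base:
  fixes f :: "real \<Rightarrow> real"
  assumes "f \<in> borel_measurable borel"
  shows "integrable (base_instance a) f"
  unfolding base_instance_def using assms
  by (auto simp: integrable_iff_bounded nn_integral_return)

lemma bandit_instance_base: "bandit_instance K base_instance"
  by (auto simp: bandit_instance_def base_instance_def intro!: prob_space_return)

lemma bandit_instance_alternative: "bandit_instance K (base_instance(i := heavy p))"
  by (auto simp: bandit_instance_def base_instance_def heavy_def
      intro!: prob_space_return measure_pmf.prob_space_distr)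

lemma arm_mean_base: "arm_mean base_instance a = base_value a"
  by (simp add: arm_mean_def integral_base)

lemma arm_mean_alternative:
  assumes "0 < p" "p \<le> 1"
  shows "arm_mean (base_instance(i := heavy p)) a = (if a = i then 2 else base_value a)"
  using assms by (simp add: arm_mean_def integral_base integral_heavy)

lemma best_mean_base: "1 \<le> K \<Longrightarrow> best_mean K base_instance = 1"
  unfolding best_mean_def arm_mean_base
  by (intro Max_eqI) (auto simp: base_value_def intro!: image_eqI[of _ _ 1])

lemma best_mean_alternative:
  assumes "0 < p" "p \<le> 1" "i \<in> {1..K}"
  shows "best_mean K (base_instance(i := heavy p)) = 2"
  unfolding best_mean_def arm_mean_alternative[OF assms(1,2)]
  using assms(3) by (intro Max_eqI) (auto simp: base_value_def intro!: image_eqI[of _ _ i])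

lemma moment_scale_base:
  assumes "1 \<le> K" "0 < \<epsilon>"
  shows "moment_scale \<epsilon> K base_instance = 1"
  unfolding moment_scale_def using assms
  by (intro Max_eqI) (auto simp: integral_base base_value_def intro!: image_eqI[of _ _ 1])

lemma base_admissible:
  assumes "1 \<le> K" "0 < \<epsilon>"
  shows "base_instance \<in> admissible_instances \<epsilon> K"
  using assms
  by (simp add: admissible_instances_def bandit_instance_base finite_moment_def moment_scale_base
      integrable_base)

lemma moment_heavy:
  assumes "0 < p" "p \<le> 1" "0 < \<epsilon>"
  shows "(\<integral>x. \<bar>x\<bar> powr (1 + \<epsilon>) \<partial>heavy p) powr (1 / (1 + \<epsilon>)) = 2 * p powr (- (\<epsilon> / (1 + \<epsilon>)))"
proof -
  have "(p * (2 / p) powr (1 + \<epsilon>)) powr (1 / (1 + \<epsilon>)) = p powr (1 / (1 + \<epsilon>)) * (2 / p)"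
    using assms by (simp add: powr_mult powr_powr)
  also have "\<dots> = 2 * p powr (1 / (1 + \<epsilon>) - 1)"
    using assms by (simp add: powr_diff)
  also have "1 / (1 + \<epsilon>) - 1 = - (\<epsilon> / (1 + \<epsilon>))"
    using assms by (simp add: field_simps)
  finally show ?thesis using assms by (simp add: integral_heavy)
qed

lemma moment_scale_alternative:
  assumes p: "0 < p" "p \<le> 1" and "0 < \<epsilon>" "i \<in> {1..K}"
  shows "moment_scale \<epsilon> K (base_instance(i := heavy p)) = 2 * p powr (- (\<epsilon> / (1 + \<epsilon>)))"
proof -
  \<comment> \<open>Hence the heavy arm has scale at least 2 and attains the maximum, the constant
    arms having scale at most 1.\<close>
  have "1 \<le> p powr (- (\<epsilon> / (1 + \<epsilon>)))"
    using powr_mono'[of "- (\<epsilon> / (1 + \<epsilon>))" 0 p] assms by simp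
  then show ?thesis
    unfolding moment_scale_def using assms
    by (intro Max_eqI)
       (auto simp: integral_base moment_heavy base_value_def intro!: image_eqI[of _ _ i])
qed

lemma alternative_admissible:
  assumes "0 < p" "p \<le> 1" "0 < \<epsilon>" "i \<in> {1..K}"
  shows "base_instance(i := heavy p) \<in> admissible_instances \<epsilon> K"
  using assms
  by (simp add: admissible_instances_def bandit_instance_alternative finite_moment_def
      moment_scale_alternative integrable_base integrable_heavy)

lemma regret_profile_ge:
  assumes "bandit_strategy \<pi>" "2 \<le> K" "0 < \<epsilon>" "\<nu> \<in> admissible_instances \<epsilon> K"
  shows "expected_regret \<pi> K T \<nu> / moment_scale \<epsilon> K \<nu> \<le> regret_profile \<pi> \<epsilon> K T"
  unfolding regret_profile_def using normalized_regret_bdd_above[OF assms(1-3)] assms(4)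
  by (intro cSUP_upper) auto

section \<open>Regret on the two instances\<close>

text \<open>The expected number of pulls of arm \<open>i\<close> on the base instance, whose table
  is almost surely the constant one used here.\<close>

definition base_pulls :: "strategy \<Rightarrow> nat \<Rightarrow> nat \<Rightarrow> nat \<Rightarrow> real" where
  "base_pulls \<pi> K T i =
     (\<Sum>as\<in>arm_paths K T. path_prob (\<pi> K T) (\<lambda>(a, s). base_value a) as * real (count_list as i))"

lemma base_pulls_nonneg: "0 \<le> base_pulls \<pi> K T i"
  by (simp add: base_pulls_def sum_nonneg path_prob_nonneg)

text \<open>Every pull of an arm other than 1 costs exactly 1, and the default values occur almost
  surely, so \<open>q = 0\<close> can be taken in \<open>expected_regret_ge\<close>.\<close>

lemma base_regret_ge:
  assumes \<pi>: "bandit_strategy \<pi>" and K: "2 \<le> K"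
  shows "(\<Sum>i\<in>{2..K}. base_pulls \<pi> K T i) \<le> expected_regret \<pi> K T base_instance"
proof -
  have gap: "(\<Sum>a\<leftarrow>as. 1 - base_value a) = (\<Sum>i\<in>{2..K}. real (count_list as i))"
    if "set as \<subseteq> {1..K}" for as
    using that
  proof (induction as)
    case (Cons a as)
    have "1 - base_value a = (\<Sum>i\<in>{2..K}. if a = i then 1 else 0)"
      using Cons.prems by (auto simp: base_value_def)
    moreover have "real (count_list (a # as) i) = (if a = i then 1 else 0) + real (count_list as i)" for i
      by simp
    ultimately show ?case
      using Cons by (simp add: sum.distrib del: count_list.simps)
  qed simp
  have q: "measure (base_instance a) {x. x \<noteq> base_value a} \<le> 0" for a
    by (simp add: base_instance_def measure_return)
  have "(\<Sum>i\<in>{2..K}. base_pulls \<pi> K T i)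
      = (\<Sum>as\<in>arm_paths K T. path_prob (\<pi> K T) (\<lambda>(a, s). base_value a) as *
          (\<Sum>i\<in>{2..K}. real (count_list as i)))"
    unfolding base_pulls_def by (subst sum.swap) (simp add: sum_distrib_left)
  also have "\<dots> = (\<Sum>as\<in>arm_paths K T. path_prob (\<pi> K T) (\<lambda>(a, s). base_value a) as *
          (\<Sum>a\<leftarrow>as. 1 - base_value a))"
    using gap by (intro sum.cong) auto
  also have "\<dots> \<le> expected_regret \<pi> K T base_instance"
    using expected_regret_ge[OF \<pi> K bandit_instance_base q, of T] K
    by (simp add: best_mean_base arm_mean_base)
  finally show ?thesis .
qed

text \<open>Along a path with \<open>n\<close> pulls of arm \<open>i\<close>, the large reward stays
  hidden with probability at least \<open>1 - p * n\<close>, and each of the other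
  \<open>T - n\<close> rounds costs at least 1.\<close>

lemma alternative_regret_ge:
  assumes \<pi>: "bandit_strategy \<pi>" and K: "2 \<le> K" and i: "i \<in> {2..K}" and p: "0 < p" "p \<le> 1"
  shows "real T - (1 + p * real T) * base_pulls \<pi> K T i
       \<le> expected_regret \<pi> K T (base_instance(i := heavy p))"
proof -
  define \<nu> where "\<nu> = base_instance(i := heavy p)"
  define q where "q = (\<lambda>a. if a = i then p else 0)"
  have gap: "real (length as) - real (count_list as i) \<le> (\<Sum>a\<leftarrow>as. best_mean K \<nu> - arm_mean \<nu> a)" for as
  proof (induction as)
    case (Cons a as)
    have "(if a = i then 0 else 1) \<le> best_mean K \<nu> - arm_mean \<nu> a"
      using i p by (auto simp: \<nu>_def best_mean_alternative arm_mean_alternative base_value_def)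
    then show ?case using Cons by (auto split: if_splits)
  qed simp
  have q_sum: "(\<Sum>a\<leftarrow>as. q a) = p * real (count_list as i)" for as
    by (induction as) (auto simp: q_def algebra_simps)
  have "measure (heavy p) {x. x \<noteq> 0} = p"
  proof -
    have "measure (heavy p) {x. x \<noteq> 0} = measure (measure_pmf (bernoulli_pmf p)) {True}"
      unfolding heavy_def using p
      by (subst measure_distr) (auto intro!: arg_cong2[where f = measure])
    then show ?thesis using p by (simp add: measure_pmf_single)
  qed
  then have q: "measure (\<nu> a) {x. x \<noteq> base_value a} \<le> q a" for a
    using i by (auto simp: \<nu>_def q_def base_instance_def measure_return base_value_def)
  have pointwise: "real T - (1 + p * real T) * real (count_list as i)
      \<le> max 0 (1 - (\<Sum>a\<leftarrow>as. q a)) * (\<Sum>a\<leftarrow>as. best_mean K \<nu> - arm_mean \<nu> a)"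
    if "length as = T" for as
  proof -
    define n where "n = real (count_list as i)"
    have n: "0 \<le> n" "n \<le> real T"
      using count_le_length[of as i] that by (auto simp: n_def)
    \<comment> \<open>The product exceeds the left side by \<open>p * n * n\<close>. Dropping this
      term leaves a bound affine in \<open>n\<close>, whose average over paths involves only the
      mean number of pulls.\<close>
    have "real T - (1 + p * real T) * n \<le> (1 - p * n) * (real T - n)"
      using p n by (simp add: algebra_simps)
    also have "\<dots> \<le> max 0 (1 - p * n) * (real T - n)"
      using n by (intro mult_right_mono) auto
    also have "\<dots> \<le> max 0 (1 - p * n) * (\<Sum>a\<leftarrow>as. best_mean K \<nu> - arm_mean \<nu> a)"
      using gap[of as] that by (intro mult_left_mono) (auto simp: n_def)
    finally show ?thesis by (simp add: q_sum n_def)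
  qed
  have "real T - (1 + p * real T) * base_pulls \<pi> K T i
      = (\<Sum>as\<in>arm_paths K T. path_prob (\<pi> K T) (\<lambda>(a, s). base_value a) as *
          (real T - (1 + p * real T) * real (count_list as i)))"
    using sum_path_prob[OF \<pi> K, of T "\<lambda>(a, s). base_value a"]
    by (simp add: base_pulls_def right_diff_distrib sum_subtractf sum_distrib_left mult.left_commute
        flip: sum_distrib_right)
  also have "\<dots> \<le> (\<Sum>as\<in>arm_paths K T. path_prob (\<pi> K T) (\<lambda>(a, s). base_value a) as *
      (max 0 (1 - (\<Sum>a\<leftarrow>as. q a)) * (\<Sum>a\<leftarrow>as. best_mean K \<nu> - arm_mean \<nu> a)))"
    by (intro sum_mono mult_left_mono pointwise path_prob_nonneg) auto
  also have "\<dots> \<le> expected_regret \<pi> K T \<nu>"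
    by (rule expected_regret_ge[OF \<pi> K _ q]) (simp only: \<nu>_def bandit_instance_alternative)
  finally show ?thesis by (simp add: \<nu>_def)
qed

section \<open>Lower bounds for the regret profile and the choice of \<open>p\<close>\<close>

lemma regret_profile_alternative_ge:
  assumes \<pi>: "bandit_strategy \<pi>" and K: "2 \<le> K" and i: "i \<in> {2..K}" and p: "0 < p" "p \<le> 1"
    and \<epsilon>: "0 < \<epsilon>"
  shows "(real T - (1 + p * real T) * base_pulls \<pi> K T i) / 2 * p powr (\<epsilon> / (1 + \<epsilon>))
       \<le> regret_profile \<pi> \<epsilon> K T"
proof -
  define \<nu> where "\<nu> = base_instance(i := heavy p)"
  have "(real T - (1 + p * real T) * base_pulls \<pi> K T i) / 2 * p powr (\<epsilon> / (1 + \<epsilon>))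
      \<le> expected_regret \<pi> K T \<nu> / 2 * p powr (\<epsilon> / (1 + \<epsilon>))"
    using alternative_regret_ge[OF \<pi> K i p, of T] unfolding \<nu>_def
    by (intro mult_right_mono divide_right_mono) auto
  also have "\<dots> = expected_regret \<pi> K T \<nu> / moment_scale \<epsilon> K \<nu>"
    using i p \<epsilon> by (simp add: \<nu>_def moment_scale_alternative powr_minus field_simps)
  also have "\<dots> \<le> regret_profile \<pi> \<epsilon> K T"
    unfolding \<nu>_def using i p \<epsilon>
    by (intro regret_profile_ge[OF \<pi> K \<epsilon>] alternative_admissible) auto
  finally show ?thesis .
qed

text \<open>Averaging over the \<open>K - 1\<close> arms other than 1: the base instance has moment
  scale 1, so the profile bounds its regret, hence the total number of these pulls.\<close>

lemma exists_rarely_pulled_arm: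
  assumes \<pi>: "bandit_strategy \<pi>" and K: "2 \<le> K" and \<epsilon>: "0 < \<epsilon>"
  obtains i where "i \<in> {2..K}" "base_pulls \<pi> K T i \<le> regret_profile \<pi> \<epsilon> K T / (real K - 1)"
proof (rule ccontr)
  assume "\<not> thesis"
  with that have "\<forall>i\<in>{2..K}. regret_profile \<pi> \<epsilon> K T / (real K - 1) < base_pulls \<pi> K T i"
    by force
  then have "(\<Sum>i\<in>{2..K}. regret_profile \<pi> \<epsilon> K T / (real K - 1)) < (\<Sum>i\<in>{2..K}. base_pulls \<pi> K T i)"
    using K by (intro sum_strict_mono) auto
  then have "regret_profile \<pi> \<epsilon> K T < (\<Sum>i\<in>{2..K}. base_pulls \<pi> K T i)"
    using K by (simp add: of_nat_diff)
  also have "\<dots> \<le> expected_regret \<pi> K T base_instance"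
    by (rule base_regret_ge[OF \<pi> K])
  also have "\<dots> \<le> regret_profile \<pi> \<epsilon> K T"
    using regret_profile_ge[OF \<pi> K \<epsilon> base_admissible, of T] K \<epsilon> by (simp add: moment_scale_base)
  finally show False by simp
qed

theorem theorem8:
  "\<exists>c\<^sub>1 :: real. c\<^sub>1 > 0 \<and>
     (\<forall>\<pi>. bandit_strategy \<pi> \<longrightarrow>
       (\<forall>(K :: nat) (T :: nat) (\<epsilon> :: real) (\<epsilon>' :: real).
          2 \<le> K \<longrightarrow> K \<le> T \<longrightarrow> 0 < \<epsilon> \<longrightarrow> \<epsilon> \<le> \<epsilon>' \<longrightarrow> \<epsilon>' \<le> 1 \<longrightarrow>
          regret_profile \<pi> \<epsilon>' K T \<le> real T / 4 \<longrightarrow>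
          regret_profile \<pi> \<epsilon> K T * regret_profile \<pi> \<epsilon>' K T powr (\<epsilon> / (1 + \<epsilon>))
            \<ge> c\<^sub>1 * real T * real K powr (\<epsilon> / (1 + \<epsilon>))))"
\<comment> \<open>The constant is \<open>1/4 * 1/8\<close>: the regret of at least
  \<open>T / 2\<close> is divided by the factor 2 in the moment scale, and \<open>1/8\<close> comes
  from comparing \<open>p * A\<close> with \<open>K\<close>.\<close>
proof (intro exI[of _ "1/32"] conjI allI impI)
  fix \<pi> K T and \<epsilon> \<epsilon>' :: real
  assume \<pi>: "bandit_strategy \<pi>" and K: "2 \<le> K" and KT: "K \<le> T"
    and \<epsilon>: "0 < \<epsilon>" "\<epsilon> \<le> \<epsilon>'" "\<epsilon>' \<le> 1" and A_le: "regret_profile \<pi> \<epsilon>' K T \<le> real T / 4"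
  define A where "A = regret_profile \<pi> \<epsilon>' K T"
  define e where "e = \<epsilon> / (1 + \<epsilon>)"
  have \<epsilon>': "0 < \<epsilon>'" using \<epsilon> by simp
  have e: "0 < e" "e \<le> 1" using \<epsilon> by (auto simp: e_def)
  obtain i where i: "i \<in> {2..K}" and "base_pulls \<pi> K T i \<le> A / (real K - 1)"
    using exists_rarely_pulled_arm[OF \<pi> K \<epsilon>'] unfolding A_def by blast
  moreover define n where "n = base_pulls \<pi> K T i"
  ultimately have n_le: "n \<le> A / (real K - 1)" by simp
  have n0: "0 \<le> n" unfolding n_def by (rule base_pulls_nonneg)
  have K1: "1 \<le> real K - 1" and T: "2 \<le> real T" using K KT by auto
  \<comment> \<open>Otherwise moving arm \<open>i\<close> to the constant reward 2 (that is, \<open>p = 1\<close>) would go unnoticed.\<close>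
  have A_ge: "(real K - 1) / 4 \<le> A"
  proof (rule ccontr)
    assume "\<not> ?thesis"
    then have "A / (real K - 1) < 1 / 4" using K1 by (simp add: field_simps)
    then have "n < 1 / 4" using n_le by linarith
    then have "(1 + real T) * n < (1 + real T) * (1 / 4)"
      by (intro mult_strict_left_mono) auto
    moreover have "(real T - (1 + real T) * n) / 2 \<le> A"
      using regret_profile_alternative_ge[OF \<pi> K i _ _ \<epsilon>', of 1 T] by (simp add: A_def n_def)
    \<comment> \<open>With \<open>n < 1/4\<close> the left side is above
      \<open>(3 * T - 1) / 8\<close>, which exceeds \<open>T / 4\<close> because
      \<open>T \<ge> 2\<close>.\<close>
    ultimately show False using A_le T unfolding A_def by argo
  qed
  then have A: "0 < A" using K1 by simp
  \<comment> \<open>Chosen so that \<open>p * A / (K - 1) = 1/4\<close>: the expected number of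
    large rewards stays at most \<open>1/4\<close>. The bound \<open>A_ge\<close> says exactly that
    \<open>p \<le> 1\<close>.\<close>
  define p where "p = (real K - 1) / (4 * A)"
  have p: "0 < p" "p \<le> 1" using A K1 A_ge by (auto simp: p_def field_simps)
  have "p * n \<le> p * (A / (real K - 1))"
    using n_le p by (intro mult_left_mono) auto
  also have "\<dots> = 1 / 4" using A K1 by (simp add: p_def)
  finally have "p * n * real T \<le> real T / 4"
    using mult_right_mono[of "p * n" "1/4" "real T"] by simp
  moreover have "n \<le> real T / 4"
  proof -
    have "A / (real K - 1) \<le> A" using A K1 by (simp add: field_simps)
    then show ?thesis using n_le A_le by (simp add: A_def)
  qed
  \<comment> \<open>Two losses of at most \<open>T / 4\<close> each: \<open>p * n * T\<close> for
    the chance that arm \<open>i\<close> reveals itself, and \<open>n\<close> for the rounds already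
    spent on it.\<close>
  ultimately have "real T / 2 \<le> real T - (1 + p * real T) * n"
    by (simp add: algebra_simps)
  then have "real T / 4 * p powr e \<le> (real T - (1 + p * real T) * n) / 2 * p powr e"
    by (intro mult_right_mono) auto
  also have "\<dots> \<le> regret_profile \<pi> \<epsilon> K T"
    using regret_profile_alternative_ge[OF \<pi> K i p \<epsilon>(1), of T] by (simp add: n_def e_def)
  finally have main: "real T / 4 * p powr e \<le> regret_profile \<pi> \<epsilon> K T" .
  \<comment> \<open>As \<open>e \<le> 1\<close>, the power \<open>(1/8) powr e\<close> is at least
    \<open>1/8\<close>, which makes the constant independent of \<epsilon>.\<close>
  have "1 / 8 * real K powr e \<le> (1 / 8) powr e * real K powr e"
    using powr_mono'[of e 1 "1/8 :: real"] e by (intro mult_right_mono) auto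
  also have "\<dots> = (real K / 8) powr e"
    using powr_mult[of "1/8" "real K" e] by simp
  \<comment> \<open>Here \<open>p * A = (K - 1) / 4\<close>, and \<open>K - 1 \<ge> K / 2\<close>
    since \<open>K \<ge> 2\<close>.\<close>
  also have "\<dots> \<le> (p * A) powr e"
    using A e K by (intro powr_mono2) (auto simp: p_def)
  also have "\<dots> = p powr e * A powr e"
    using p A by (simp add: powr_mult)
  finally have "real T / 4 * (1 / 8 * real K powr e) \<le> real T / 4 * (p powr e * A powr e)"
    by (intro mult_left_mono) auto
  also have "\<dots> = real T / 4 * p powr e * A powr e" by simp
  also have "\<dots> \<le> regret_profile \<pi> \<epsilon> K T * A powr e"
    using main by (intro mult_right_mono) auto
  finally show "1 / 32 * real T * real K powr (\<epsilon> / (1 + \<epsilon>))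
      \<le> regret_profile \<pi> \<epsilon> K T * regret_profile \<pi> \<epsilon>' K T powr (\<epsilon> / (1 + \<epsilon>))"
    by (simp add: A_def e_def)
qed simp

end
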